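(* Let $t \in \Sigma^*$ be a finite trace and $\varphi$ an LTL formula. Then: (1) $t \in [\![\varphi]\!]_3(\mathrm{T}) \iff \forall u \in \Sigma^\omega.\ tu \in [\![\varphi]\!](\mathrm{T})$; (2) $t \in [\![\varphi]\!]_3(\mathrm{F}) \iff \forall u \in \Sigma^\omega.\ tu \in [\![\varphi]\!](\mathrm{F})$.
   Context: Traces. Fix a set $A$ of atomic propositions and let $\Sigma = \mathcal{P}(A)$ be the set of states. $\Sigma^*$ is the set of finite traces (including the empty trace $\varepsilon$), $\Sigma^\omega$ the set of infinite traces, $\Sigma^\infty = \Sigma^* \cup \Sigma^\omega$. Concatenation is written $tu$, with $tu = t$ if $t$ is infinite. $t_0$ is the first state of a nonempty trace $t$; $t|_n$ is $t$ without its first $n$ states ($\varepsilon$ if $n$ exceeds the length of $t$). Definitive sets. For $X \subseteq \Sigma^\infty$, $\downarrow X = \{u \mid \exists t \in X.\ \exists v \in \Sigma^\infty.\ t = uv\}$; $\uparrow t = \{tu \mid u \in \Sigma^\infty\}$; $\mathrm{dp}(X) = \{t \in \Sigma^\infty\mid \uparrow t \subseteq \downarrow X\}$. $X$ is definitive iff $X = \mathrm{dp}(X)$. Definitive union: $X \sqcup Y = \mathrm{dp}(X \cup Y)$ and $\bigsqcup S = \mathrm{dp}(\bigcup S)$. Prepend: $\triangleright X = \{t \in \Sigma^\infty \mid t|_1 \in X\}$. LTL formulae: $\varphi,\psi ::= \top \mid a \mid \neg\varphi \mid \varphi\wedge\psi \mid \bigcirc\varphi \mid \varphi\,\mathcal{U}\,\psi$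 with $a \in A$; $\varphi\vee\psi$ abbreviates $\neg(\neg\varphi\wedge\neg\psi)$. Conventional LTL semantics $[\![\varphi]\!] : \{\mathrm{T},\mathrm{F}\} \to \mathcal{P}(\Sigma^\omega)$, by recursion: $[\![\top]\!](\mathrm{T}) = \Sigma^\omega$, $[\![\top]\!](\mathrm{F}) = \emptyset$; $[\![a]\!](\mathrm{T}) = \{t\in\Sigma^\omega \mid a \in t_0\}$, $[\![a]\!](\mathrm{F}) = \{t\in\Sigma^\omega \mid a \notin t_0\}$; $[\![\neg\varphi]\!](\mathrm{T}) = [\![\varphi]\!](\mathrm{F})$, $[\![\neg\varphi]\!](\mathrm{F}) = [\![\varphi]\!](\mathrm{T})$; $[\![\varphi\wedge\psi]\!](\mathrm{T}) = [\![\varphi]\!](\mathrm{T})\cap[\![\psi]\!](\mathrm{T})$, $[\![\varphi\wedge\psi]\!](\mathrm{F}) = [\![\varphi]\!](\mathrm{F})\cup[\![\psi]\!](\mathrm{F})$; $[\![\bigcirc\varphi]\!](b) = \{t \mid t|_1 \in [\![\varphi]\!](b)\}$ for $b\in\{\mathrm{T},\mathrm{F}\}$; $[\![\varphi\,\mathcal{U}\,\psi]\!](\mathrm{T}) = \{t \mid \exists k.\ (\forall i<k.\ t|_i \in [\![\varphi]\!](\mathrm{T})) \wedge t|_k \in [\![\psi]\!](\mathrm{T})\}$, $[\![\varphi\,\mathcal{U}\,\psi]\!](\mathrm{F}) = \{t \mid \forall k.\ (\exists i<k.\ t|_i \in [\![\varphi]\!](\mathrm{F})) \vee t|_k \in [\![\psi]\!](\mathrm{F})\}$.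 LTL$_3$ semantics $[\![\varphi]\!]_3$ assigns to each answer in $\{\mathrm{T},\mathrm{F}\}$ a definitive set, by recursion: $[\![\top]\!]_3(\mathrm{T}) = \Sigma^\infty$, $[\![\top]\!]_3(\mathrm{F}) = \emptyset$; $[\![a]\!]_3(\mathrm{T}) = \mathrm{dp}\{t\in\Sigma^\infty \mid t\ne\varepsilon \wedge a \in t_0\}$, $[\![a]\!]_3(\mathrm{F}) = \mathrm{dp}\{t\in\Sigma^\infty \mid t\neq\varepsilon \wedge a \notin t_0\}$; $[\![\neg\varphi]\!]_3(\mathrm{T}) = [\![\varphi]\!]_3(\mathrm{F})$, $[\![\neg\varphi]\!]_3(\mathrm{F}) = [\![\varphi]\!]_3(\mathrm{T})$; $[\![\varphi\wedge\psi]\!]_3(\mathrm{T}) = [\![\varphi]\!]_3(\mathrm{T})\cap[\![\psi]\!]_3(\mathrm{T})$, $[\![\varphi\wedge\psi]\!]_3(\mathrm{F}) = [\![\varphi]\!]_3(\mathrm{F})\sqcup[\![\psi]\!]_3(\mathrm{F})$; $[\![\bigcirc\varphi]\!]_3(b) = \triangleright([\![\varphi]\!]_3(b))$ for $b\in\{\mathrm{T},\mathrm{F}\}$; $[\![\varphi\,\mathcal{U}\,\psi]\!]_3(\mathrm{T}) = \bigsqcup_{k\in\mathbb{N}} f^k([\![\psi]\!]_3(\mathrm{T}))$ where $f(X) = \triangleright X \cap [\![\varphi]\!]_3(\mathrm{T})$; $[\![\varphi\,\mathcal{U}\,\psi]\!]_3(\mathrm{F}) = \bigcap_{k\in\mathbb{N}}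 g^k([\![\psi]\!]_3(\mathrm{F}))$ where $g(X) = \triangleright X \sqcup [\![\varphi]\!]_3(\mathrm{F})$. Here $f^k$ is the $k$-fold self-composition of $f$ ($f^0$ the identity). *)

theory Defs
  imports Main "HOL-Library.Stream"
begin

datatype 's trace = Finite "'s list" | Infinite "'s stream"

abbreviation empty_trace :: "'s trace" ("\<epsilon>") where
  "\<epsilon> \<equiv> Finite []"

fun tconc :: "'s trace \<Rightarrow> 's trace \<Rightarrow> 's trace" (infixr "\<cdot>" 65) where
  "Finite xs \<cdot> Finite ys = Finite (xs @ ys)"
| "Finite xs \<cdot> Infinite s = Infinite (xs @- s)"
| "Infinite s \<cdot> t = Infinite s"

text \<open>The first state; its value on the empty trace is unspecified, and every use below excludes
  that trace.\<close>

fun thd :: "'s trace \<Rightarrow> 's" where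
  "thd (Finite xs) = hd xs"
| "thd (Infinite s) = shd s"

fun tdrop :: "nat \<Rightarrow> 's trace \<Rightarrow> 's trace" where
  "tdrop n (Finite xs) = Finite (drop n xs)"
| "tdrop n (Infinite s) = Infinite (sdrop n s)"

datatype (atoms: 'a) ltl =
    Top
  | Atom 'a
  | Neg "'a ltl"
  | Conj "'a ltl" "'a ltl"
  | Next "'a ltl"
  | Until "'a ltl" "'a ltl"

text \<open>The set of atomic propositions is an arbitrary, possibly empty, set \<open>A\<close> rather than a type.
  Outside this context it is the first argument of each constant defined here. States are the
  subsets of \<open>A\<close>; the formulae over \<open>A\<close> are those with \<open>atoms \<phi> \<subseteq> A\<close>. The answers T and F are the
  Booleans.\<close>

context
  fixes A :: "'a set"
begin

definition fin_traces :: "'a set trace set" where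
  "fin_traces = Finite ` lists (Pow A)"

definition inf_traces :: "'a set trace set" where
  "inf_traces = Infinite ` streams (Pow A)"

definition traces :: "'a set trace set" where
  "traces = fin_traces \<union> inf_traces"

definition prefixes :: "'a set trace set \<Rightarrow> 'a set trace set" where
  "prefixes X = {u \<in> traces. \<exists>t\<in>X. \<exists>v\<in>traces. t = u \<cdot> v}"

definition extensions :: "'a set trace \<Rightarrow> 'a set trace set" where
  "extensions t = {t \<cdot> u |u. u \<in> traces}"

definition dp :: "'a set trace set \<Rightarrow> 'a set trace set" where
  "dp X = {t \<in> traces. extensions t \<subseteq> prefixes X}"

definition dunion :: "'a set trace set \<Rightarrow> 'a set trace set \<Rightarrow> 'a set trace set" where
  "dunion X Y = dp (X \<union> Y)"

definition dUnion :: "'a set trace set set \<Rightarrow> 'a set trace set" where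
  "dUnion S = dp (\<Union>S)"

definition prepend :: "'a set trace set \<Rightarrow> 'a set trace set" where
  "prepend X = {t \<in> traces. tdrop 1 t \<in> X}"

fun ltl_sem :: "'a ltl \<Rightarrow> bool \<Rightarrow> 'a set trace set" where
  "ltl_sem Top True = inf_traces"
| "ltl_sem Top False = {}"
| "ltl_sem (Atom a) True = {t \<in> inf_traces. a \<in> thd t}"
| "ltl_sem (Atom a) False = {t \<in> inf_traces. a \<notin> thd t}"
| "ltl_sem (Neg \<phi>) True = ltl_sem \<phi> False"
| "ltl_sem (Neg \<phi>) False = ltl_sem \<phi> True"
| "ltl_sem (Conj \<phi> \<psi>) True = ltl_sem \<phi> True \<inter> ltl_sem \<psi> True"
| "ltl_sem (Conj \<phi> \<psi>) False = ltl_sem \<phi> False \<union> ltl_sem \<psi> False"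
| "ltl_sem (Next \<phi>) b = {t \<in> inf_traces. tdrop 1 t \<in> ltl_sem \<phi> b}"
| "ltl_sem (Until \<phi> \<psi>) True =
     {t \<in> inf_traces. \<exists>k. (\<forall>i<k. tdrop i t \<in> ltl_sem \<phi> True) \<and> tdrop k t \<in> ltl_sem \<psi> True}"
| "ltl_sem (Until \<phi> \<psi>) False =
     {t \<in> inf_traces. \<forall>k. (\<exists>i<k. tdrop i t \<in> ltl_sem \<phi> False) \<or> tdrop k t \<in> ltl_sem \<psi> False}"

fun ltl3_sem :: "'a ltl \<Rightarrow> bool \<Rightarrow> 'a set trace set" where
  "ltl3_sem Top True = traces"
| "ltl3_sem Top False = {}"
| "ltl3_sem (Atom a) True = dp {t \<in> traces. t \<noteq> \<epsilon> \<and> a \<in> thd t}"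
| "ltl3_sem (Atom a) False = dp {t \<in> traces. t \<noteq> \<epsilon> \<and> a \<notin> thd t}"
| "ltl3_sem (Neg \<phi>) True = ltl3_sem \<phi> False"
| "ltl3_sem (Neg \<phi>) False = ltl3_sem \<phi> True"
| "ltl3_sem (Conj \<phi> \<psi>) True = ltl3_sem \<phi> True \<inter> ltl3_sem \<psi> True"
| "ltl3_sem (Conj \<phi> \<psi>) False = dunion (ltl3_sem \<phi> False) (ltl3_sem \<psi> False)"
| "ltl3_sem (Next \<phi>) b = prepend (ltl3_sem \<phi> b)"
| "ltl3_sem (Until \<phi> \<psi>) True =
     dUnion (range (\<lambda>k. ((\<lambda>X. prepend X \<inter> ltl3_sem \<phi> True) ^^ k) (ltl3_sem \<psi> True)))"
| "ltl3_sem (Until \<phi> \<psi>) False =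
     (\<Inter>k. ((\<lambda>X. dunion (prepend X) (ltl3_sem \<phi> False)) ^^ k) (ltl3_sem \<psi> False))"

end

end

theory Submission
  imports Defs
begin

text \<open>The set of states is never empty, since it contains the empty set of propositions, so every
  finite trace has an infinite extension. Hence \<open>dp X\<close> only depends on the infinite traces in \<open>X\<close>:
  it consists of the traces all of whose infinite extensions lie in \<open>X\<close>. Definitive sets thus
  correspond bijectively to sets of infinite traces, and under this bijection each clause of the
  three-valued semantics turns into the matching clause of the conventional semantics.\<close>

definition determined :: "'a set \<Rightarrow> 'a set trace set \<Rightarrow> 'a set trace set" where
  "determined A Y = {t \<in> traces A. \<forall>u\<in>inf_traces A. t \<cdot> u \<in> Y}"

lemma inf_traces_nonempty: "\<exists>u. u \<in> inf_traces A"
proof -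
  have "Infinite (sconst {}) \<in> inf_traces A"
    by (simp add: inf_traces_def streams_iff_sset)
  then show ?thesis ..
qed

lemma inf_tracesE:
  assumes "u \<in> inf_traces A"
  obtains s where "u = Infinite s" "s \<in> streams (Pow A)"
  using assms by (auto simp: inf_traces_def)

lemma tconc_inf: "t \<in> inf_traces A \<Longrightarrow> t \<cdot> u = t"
  by (auto elim: inf_tracesE)

lemma inf_traces_subset: "inf_traces A \<subseteq> traces A"
  by (simp add: traces_def)

lemma tconc_assoc: "(t \<cdot> u) \<cdot> v = t \<cdot> (u \<cdot> v)"
  by (cases t; cases u; cases v) auto

lemma tconc_inf_traces:
  "t \<in> traces A \<Longrightarrow> u \<in> inf_traces A \<Longrightarrow> t \<cdot> u \<in> inf_traces A"
  by (auto simp: traces_def fin_traces_def inf_traces_def lists_eq_set streams_iff_sset)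

lemma tconc_traces: "t \<in> traces A \<Longrightarrow> u \<in> traces A \<Longrightarrow> t \<cdot> u \<in> traces A"
  by (auto simp: traces_def fin_traces_def inf_traces_def lists_eq_set image_iff streams_iff_sset)

lemma tdrop_inf_traces: "t \<in> inf_traces A \<Longrightarrow> tdrop n t \<in> inf_traces A"
  by (auto simp: inf_traces_def streams_iff_snth sdrop_snth simp del: Pow_iff intro!: imageI)

lemma tdrop_traces: "t \<in> traces A \<Longrightarrow> tdrop n t \<in> traces A"
  using tdrop_inf_traces[of t A n]
  by (auto simp: traces_def fin_traces_def intro!: imageI dest!: in_set_dropD) blast

lemma tdrop_tdrop: "tdrop m (tdrop n t) = tdrop (m + n) t"
  by (cases t) (simp_all add: add.commute)

lemma tdrop_0: "tdrop 0 t = t"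
  by (cases t) auto

text \<open>An infinite trace absorbs whatever is appended to it, so it is a prefix of itself
  only.\<close>

lemma inf_prefixes_iff: "u \<in> inf_traces A \<Longrightarrow> u \<in> prefixes A X \<longleftrightarrow> u \<in> X"
  using inf_traces_subset[of A] inf_traces_nonempty[of A]
  by (fastforce simp: prefixes_def tconc_inf)

lemma dp_eq_determined: "dp A X = determined A X"
proof (intro set_eqI iffI)
  fix t assume "t \<in> dp A X"
  then have t: "t \<in> traces A" and ext: "\<And>u. u \<in> traces A \<Longrightarrow> t \<cdot> u \<in> prefixes A X"
    by (auto simp: dp_def extensions_def)
  have "t \<cdot> u \<in> X" if "u \<in> inf_traces A" for u
    using that ext[of u] inf_traces_subset tconc_inf_traces[OF t that] inf_prefixes_iff by blast
  with t show "t \<in> determined A X"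
    by (simp add: determined_def)
next
  fix t assume "t \<in> determined A X"
  then have t: "t \<in> traces A" and det: "\<And>u. u \<in> inf_traces A \<Longrightarrow> t \<cdot> u \<in> X"
    by (auto simp: determined_def)
  obtain w where w: "w \<in> inf_traces A"
    using inf_traces_nonempty by blast
  have "t \<cdot> u \<in> prefixes A X" if u: "u \<in> traces A" for u
  proof -
    \<comment> \<open>Appending \<open>w\<close> turns a possibly finite \<open>t \<cdot> u\<close>
      into an infinite extension of \<open>t\<close>; this member of \<open>X\<close> then witnesses
      that \<open>t \<cdot> u\<close> is a prefix.\<close>
    have "(t \<cdot> u) \<cdot> w \<in> X"
      using det[OF tconc_inf_traces[OF u w]] by (simp add: tconc_assoc)
    then show ?thesis
      using tconc_traces[OF t u] w inf_traces_subset unfolding prefixes_def by blast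
  qed
  with t show "t \<in> dp A X"
    by (auto simp: dp_def extensions_def)
qed

text \<open>Every trace tested for membership has the form \<open>t \<cdot> u\<close> with
  \<open>u\<close> infinite, hence is infinite itself.\<close>

lemma determined_cong:
  assumes "\<And>t. t \<in> inf_traces A \<Longrightarrow> t \<in> X \<longleftrightarrow> t \<in> Y"
  shows "determined A X = determined A Y"
  using assms tconc_inf_traces by (fastforce simp: determined_def)

lemma inf_determined_iff: "t \<in> inf_traces A \<Longrightarrow> t \<in> determined A Y \<longleftrightarrow> t \<in> Y"
  using inf_traces_subset[of A] inf_traces_nonempty[of A]
  by (auto simp: determined_def tconc_inf)

lemma determined_empty: "determined A {} = {}"
  using inf_traces_nonempty[of A] by (auto simp: determined_def)

lemma determined_inf_traces: "determined A (inf_traces A) = traces A"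
  by (auto simp: determined_def tconc_inf_traces)

lemma determined_Int: "determined A X \<inter> determined A Y = determined A (X \<inter> Y)"
  by (auto simp: determined_def)

lemma determined_INT: "(\<Inter>k. determined A (X k)) = determined A (\<Inter>k. X k)"
  by (auto simp: determined_def)

text \<open>A finite trace may have some infinite extensions in \<open>X\<close> and the others in
  \<open>Y\<close>, so the plain union can be too small. It has the same infinite traces as
  \<open>X \<union> Y\<close>, though, and \<open>dp\<close> sees only those.\<close>

lemma dunion_determined:
  "dunion A (determined A X) (determined A Y) = determined A (X \<union> Y)"
  unfolding dunion_def dp_eq_determined by (rule determined_cong) (simp add: inf_determined_iff)

lemma dUnion_determined:
  "dUnion A (range (\<lambda>k. determined A (X k))) = determined A (\<Union>k. X k)"
  unfolding dUnion_def dp_eq_determined by (rule determined_cong) (simp add: inf_determined_iff)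

text \<open>The delicate case is the empty trace, where \<open>tdrop 1 \<epsilon> = \<epsilon>\<close>: there one uses that every
  infinite trace is the tail of another one.\<close>

lemma prepend_determined:
  "prepend A (determined A Y) = determined A {t \<in> inf_traces A. tdrop 1 t \<in> Y}" (is "?L = ?R")
proof (rule set_eqI)
  fix t
  show "t \<in> ?L \<longleftrightarrow> t \<in> ?R"
  proof (cases "t \<in> traces A")
    case t: True
    have "(\<forall>u\<in>inf_traces A. tdrop 1 t \<cdot> u \<in> Y) \<longleftrightarrow> (\<forall>u\<in>inf_traces A. tdrop 1 (t \<cdot> u) \<in> Y)"
    proof (cases "t = \<epsilon>")
      case True
      have "\<exists>v\<in>inf_traces A. tdrop 1 v = u" if u: "u \<in> inf_traces A" for u
      proof
        \<comment> \<open>The state \<open>{}\<close> is available over every \<open>A\<close>, even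
          an empty one.\<close>
        show "Finite [{}] \<cdot> u \<in> inf_traces A"
          using u by (intro tconc_inf_traces) (auto simp: traces_def fin_traces_def)
        show "tdrop 1 (Finite [{}] \<cdot> u) = u"
          using u by (auto elim: inf_tracesE)
      qed
      moreover have "\<epsilon> \<cdot> u = u" for u :: "'a set trace"
        by (cases u) auto
      ultimately show ?thesis
        unfolding True by (metis tdrop.simps(1) drop_Nil tdrop_inf_traces)
    next
      case False
      have "tdrop 1 t \<cdot> u = tdrop 1 (t \<cdot> u)" for u
        \<comment> \<open>The last case split exposes the first state of a finite \<open>t\<close>,
          so that dropping it leaves \<open>u\<close> untouched.\<close>
        using False by (cases t; cases u; cases "case t of Finite xs \<Rightarrow> xs") auto
      then show ?thesis
        by simp
    qed
    then show ?thesis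
      using t by (auto simp: prepend_def determined_def tdrop_traces tconc_inf_traces)
  qed (auto simp: prepend_def determined_def)
qed

text \<open>Each application shifts the earlier constraints by one position and imposes
  \<open>P\<close> at position 0, so \<open>Q\<close> ends up at position \<open>k\<close>.\<close>

lemma until_true_iterate:
  "((\<lambda>X. prepend A X \<inter> determined A P) ^^ k) (determined A Q) =
     determined A {t \<in> inf_traces A. (\<forall>i<k. tdrop i t \<in> P) \<and> tdrop k t \<in> Q}"
proof (induction k)
  case 0
  show ?case
    by (simp add: tdrop_0) (rule determined_cong, simp)
next
  case (Suc k)
  \<comment> \<open>The new application is the outermost one, so the bounded quantifier is split at
    \<open>i = 0\<close> rather than at \<open>i = k\<close>.\<close>
  show ?case
    unfolding funpow.simps o_apply Suc.IH prepend_determined determined_Int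
    by (rule determined_cong)
       (auto simp: tdrop_inf_traces tdrop_tdrop tdrop_0 All_less_Suc2 simp del: tdrop.simps)
qed

text \<open>Dual to the previous iteration: each application shifts and adds \<open>P\<close> at
  position 0 as an alternative.\<close>

lemma until_false_iterate:
  "((\<lambda>X. dunion A (prepend A X) (determined A P)) ^^ k) (determined A Q) =
     determined A {t \<in> inf_traces A. (\<exists>i<k. tdrop i t \<in> P) \<or> tdrop k t \<in> Q}"
proof (induction k)
  case 0
  show ?case
    by (simp add: tdrop_0) (rule determined_cong, simp)
next
  case (Suc k)
  show ?case
    unfolding funpow.simps o_apply Suc.IH prepend_determined dunion_determined
    by (rule determined_cong)
       (auto simp: tdrop_inf_traces tdrop_tdrop tdrop_0 Ex_less_Suc2 simp del: tdrop.simps)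
qed

lemma ltl3_sem_eq_determined: "ltl3_sem A \<phi> b = determined A (ltl_sem A \<phi> b)"
\<comment> \<open>The answer is generalised because negation swaps the two answers.\<close>
proof (induction \<phi> arbitrary: b)
  case Top
  show ?case
    by (cases b) (simp_all add: determined_inf_traces determined_empty)
next
  case (Atom a)
  \<comment> \<open>The two clauses differ only on finite traces, since no infinite trace equals
    \<epsilon>.\<close>
  show ?case
    using inf_traces_subset[of A]
    by (cases b) (auto simp: dp_eq_determined elim: inf_tracesE intro!: determined_cong)
next
  case (Neg \<phi>)
  then show ?case
    by (cases b) simp_all
next
  case (Conj \<phi> \<psi>)
  then show ?case
    by (cases b) (simp_all add: determined_Int dunion_determined)
next
  case (Next \<phi>)
  then show ?case
    by (simp add: prepend_determined)
next
  case (Until \<phi> \<psi>)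
  show ?case
  proof (cases b)
    case True
    then have b: "b = True" by simp
    \<comment> \<open>The union of the iterates over all \<open>k\<close> supplies the existential
      quantifier of the conventional clause; in the other case the intersection supplies the
      universal one.\<close>
    show ?thesis
      unfolding b ltl3_sem.simps ltl_sem.simps Until.IH until_true_iterate dUnion_determined
      by (rule determined_cong) auto
  next
    case False
    then have b: "b = False" by simp
    show ?thesis
      unfolding b ltl3_sem.simps ltl_sem.simps Until.IH until_false_iterate determined_INT
      by (rule determined_cong) auto
  qed
qed

theorem theorem6:
  fixes A :: "'a set" and t :: "'a set trace" and \<phi> :: "'a ltl"
  assumes "t \<in> fin_traces A"
    and "atoms \<phi> \<subseteq> A"
  shows "(t \<in> ltl3_sem A \<phi> True \<longleftrightarrow> (\<forall>u\<in>inf_traces A. t \<cdot> u \<in> ltl_sem A \<phi> True)) \<and>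
         (t \<in> ltl3_sem A \<phi> False \<longleftrightarrow> (\<forall>u\<in>inf_traces A. t \<cdot> u \<in> ltl_sem A \<phi> False))"
  \<comment> \<open>For a finite trace, membership in \<open>determined\<close> is literally the
    right-hand side of each equivalence.\<close>
  using assms(1) by (simp add: ltl3_sem_eq_determined determined_def traces_def)

end
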